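(* Let $\mathcal A_4$ be the variety generated by the class of all additively idempotent semirings having exactly four elements. Then $\mathcal A_4$ is nonfinitely based, i.e. there is no finite set of identities that defines $\mathcal A_4$.
   Context: An additively idempotent semiring (ai-semiring) is an algebra $(S,+,\cdot)$ of signature $(+,\cdot)$ with two binary operations and no constants, such that $(S,+)$ is a commutative idempotent semigroup, $(S,\cdot)$ is a semigroup (not necessarily commutative), and $x(y+z)=xy+xz$, $(x+y)z=xz+yz$ hold. The variety generated by a class $\mathcal K$ of algebras is the smallest class of algebras of this signature containing $\mathcal K$ and definable by identities. A variety is finitely based if it can be defined by finitely many identities (in the signature $(+,\cdot)$), and nonfinitely based otherwise. *)

theory Defs imports Main begin

text \<open>
  Algebras of signature \<open>(+, \<cdot>)\<close> have a carrier inside a fixed universe type \<open>'a\<close>; the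
  operations are irrelevant outside the carrier. A class of algebras is a set of type
  \<open>'a alg set\<close>.
  Terms use countably many variables, so every variety is determined by its finitely generated
  (hence countable) members, and any infinite type \<open>'a\<close> contains a copy of each of these.
\<close>

record 'a alg =
  carrier :: "'a set"
  plus :: "'a \<Rightarrow> 'a \<Rightarrow> 'a" (infixl "\<oplus>\<index>" 65)
  times :: "'a \<Rightarrow> 'a \<Rightarrow> 'a" (infixl "\<otimes>\<index>" 70)

hide_const (open) plus times carrier

definition algebra :: "'a alg \<Rightarrow> bool" where
  "algebra S \<longleftrightarrow> alg.carrier S \<noteq> {} \<and>
     (\<forall>x \<in> alg.carrier S. \<forall>y \<in> alg.carrier S.
        x \<oplus>\<^bsub>S\<^esub> y \<in> alg.carrier S \<and> x \<otimes>\<^bsub>S\<^esub> y \<in> alg.carrier S)"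

definition ai_semiring :: "'a alg \<Rightarrow> bool" where
  "ai_semiring S \<longleftrightarrow> algebra S \<and>
     (\<forall>x \<in> alg.carrier S. \<forall>y \<in> alg.carrier S. \<forall>z \<in> alg.carrier S.
        (x \<oplus>\<^bsub>S\<^esub> y) \<oplus>\<^bsub>S\<^esub> z = x \<oplus>\<^bsub>S\<^esub> (y \<oplus>\<^bsub>S\<^esub> z) \<and>
        x \<oplus>\<^bsub>S\<^esub> y = y \<oplus>\<^bsub>S\<^esub> x \<and>
        x \<oplus>\<^bsub>S\<^esub> x = x \<and>
        (x \<otimes>\<^bsub>S\<^esub> y) \<otimes>\<^bsub>S\<^esub> z = x \<otimes>\<^bsub>S\<^esub> (y \<otimes>\<^bsub>S\<^esub> z) \<and>
        x \<otimes>\<^bsub>S\<^esub> (y \<oplus>\<^bsub>S\<^esub> z) = (x \<otimes>\<^bsub>S\<^esub> y) \<oplus>\<^bsub>S\<^esub> (x \<otimes>\<^bsub>S\<^esub> z) \<and>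
        (x \<oplus>\<^bsub>S\<^esub> y) \<otimes>\<^bsub>S\<^esub> z = (x \<otimes>\<^bsub>S\<^esub> z) \<oplus>\<^bsub>S\<^esub> (y \<otimes>\<^bsub>S\<^esub> z))"

datatype trm = Var nat | Plus trm trm | Times trm trm

type_synonym ident = "trm \<times> trm"

primrec interp :: "'a alg \<Rightarrow> (nat \<Rightarrow> 'a) \<Rightarrow> trm \<Rightarrow> 'a" where
  "interp S \<phi> (Var i) = \<phi> i"
| "interp S \<phi> (Plus s t) = interp S \<phi> s \<oplus>\<^bsub>S\<^esub> interp S \<phi> t"
| "interp S \<phi> (Times s t) = interp S \<phi> s \<otimes>\<^bsub>S\<^esub> interp S \<phi> t"

definition satisfies :: "'a alg \<Rightarrow> ident \<Rightarrow> bool" where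
  "satisfies S e \<longleftrightarrow>
     (\<forall>\<phi>. range \<phi> \<subseteq> alg.carrier S \<longrightarrow> interp S \<phi> (fst e) = interp S \<phi> (snd e))"

definition models :: "ident set \<Rightarrow> 'a alg set" where
  "models E = {S. algebra S \<and> (\<forall>e \<in> E. satisfies S e)}"

definition variety :: "'a alg set \<Rightarrow> bool" where
  "variety V \<longleftrightarrow> (\<exists>E. V = models E)"

definition finitely_based :: "'a alg set \<Rightarrow> bool" where
  "finitely_based V \<longleftrightarrow> (\<exists>E. finite E \<and> V = models E)"

definition variety_generated :: "'a alg set \<Rightarrow> 'a alg set" where
  "variety_generated K = \<Inter> {V. variety V \<and> K \<subseteq> V}"

text \<open>The intersection above is itself a variety, hence the smallest one containing \<open>K\<close>.\<close>

lemma variety_variety_generated: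
  assumes "\<And>S. S \<in> K \<Longrightarrow> algebra S"
  shows "variety (variety_generated K)"
proof -
  let ?E = "\<Union> {E. K \<subseteq> models E}"
  have "K \<subseteq> models {}"
    using assms by (auto simp: models_def)
  then have "variety_generated K = models ?E"
    unfolding variety_generated_def variety_def models_def by blast
  then show ?thesis
    unfolding variety_def by blast
qed

lemma subset_variety_generated: "K \<subseteq> variety_generated K"
  by (auto simp: variety_generated_def)

lemma variety_generated_least: "variety V \<Longrightarrow> K \<subseteq> V \<Longrightarrow> variety_generated K \<subseteq> V"
  by (auto simp: variety_generated_def)

definition A4 :: "'a alg set" where
  "A4 = variety_generated {S. ai_semiring S \<and> card (alg.carrier S) = 4}"

end

theory Submission
  imports Defs "HOL-Library.Multiset" "HOL-Library.Countable_Set"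
begin

text \<open>
  Let \<open>x\<^sub>0, \<dots>, x\<^sub>N\<close> be the points of a near-pencil: its blocks are \<open>{x\<^sub>0, \<dots>, x\<^bsub>N-1\<^esub>}\<close> and the pairs
  \<open>{x\<^sub>i, x\<^sub>N}\<close>. Every pair of points lies in a block, so if every block contains at most one
  \<open>a\<close>, then so does the whole point set. This gives inequalities
  \<open>x\<^sub>0 \<cdots> x\<^sub>N \<le> x\<^sub>0 \<cdots> x\<^bsub>N-1\<^esub> + (\<Sum>i<N. x\<^sub>i x\<^sub>N) + \<dots>\<close>, where the omitted summands and a padding of the
  variables make them valid in all four-element ai-semirings: if the inequality failed, the
  four elements would have to be a unit \<open>e\<close>, the right-hand side \<open>s\<close>, the left-hand side \<open>u\<close> and an
  element \<open>y\<close> generating an ideal below \<open>s\<close>; then all \<open>x\<^sub>i\<close> lie in \<open>{e, s}\<close>, which is impossible.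

  A near-pencil has no proper subspaces besides its blocks and points, and all \<open>N + 1\<close> blocks are
  needed to cover all pairs. Hence in the syntactic semiring of the set of blocks (enlarged by
  the words containing a bottom element) the inequality fails, while the identities of the
  four-element chain \<open>0 < 1 < a < a\<^sup>2\<close> that are short compared to \<open>N\<close> remain valid: the chain
  detects a pair of letters occurring in a word over a prescribed set of letters.
\<close>

section \<open>Terms of the near-pencil inequalities\<close>

fun pow_trm :: "trm \<Rightarrow> nat \<Rightarrow> trm" where
  "pow_trm t 0 = t"
| "pow_trm t (Suc k) = Times (pow_trm t k) t"

fun sum_trm :: "(nat \<Rightarrow> trm) \<Rightarrow> nat \<Rightarrow> trm" where
  "sum_trm f 0 = f 0"
| "sum_trm f (Suc k) = Plus (sum_trm f k) (f (Suc k))"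

fun prod_trm :: "(nat \<Rightarrow> trm) \<Rightarrow> nat \<Rightarrow> trm" where
  "prod_trm f 0 = f 0"
| "prod_trm f (Suc k) = Times (prod_trm f k) (f (Suc k))"

text \<open>
  In four-element semigroups \<open>t\<^sup>1\<^sup>2\<close> is idempotent, and \<open>pow_trm t 11\<close> is \<open>t\<^sup>1\<^sup>2\<close>. The terms \<open>loc_trm n i\<close>
  take values in the local monoid of this idempotent.
\<close>

definition unit_trm :: "nat \<Rightarrow> trm" where
  "unit_trm n = pow_trm (Var (n + 3)) 11"

definition loc_trm :: "nat \<Rightarrow> nat \<Rightarrow> trm" where
  "loc_trm n i = Times (Times (unit_trm n) (Var i)) (unit_trm n)"

definition base_trm :: "nat \<Rightarrow> trm" where
  "base_trm n = Plus (unit_trm n) (sum_trm (loc_trm n) (Suc n))"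

text \<open>The twelfth power of the base term is an idempotent above the unit and above all
  products of \<open>x_0, ..., x_(n+1)\<close>. This single summand therefore bounds every product
  of such elements with one factor \<open>x_(n+2)\<close> among them.\<close>

definition ideal_trm :: "nat \<Rightarrow> trm" where
  "ideal_trm n =
     Times (Times (pow_trm (base_trm n) 11) (loc_trm n (n + 2))) (pow_trm (base_trm n) 11)"

text \<open>The near-pencil has \<open>N = n + 1\<close>: the second summand lists the pairs with
  the point \<open>N\<close>, the third is the long block.\<close>

definition upper_trm :: "nat \<Rightarrow> trm" where
  "upper_trm n =
     Plus (Plus (Plus (base_trm n)
       (Times (sum_trm (loc_trm n) n) (loc_trm n (Suc n))))
       (prod_trm (loc_trm n) n))
       (ideal_trm n)"

definition lower_trm :: "nat \<Rightarrow> trm" where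
  "lower_trm n = prod_trm (loc_trm n) (Suc n)"

definition pencil_ident :: "nat \<Rightarrow> ident" where
  "pencil_ident n = (Plus (upper_trm n) (lower_trm n), upper_trm n)"

lemma interp_in_carrier:
  assumes "algebra S" "range \<phi> \<subseteq> alg.carrier S"
  shows "interp S \<phi> t \<in> alg.carrier S"
  using assms by (induction t) (auto simp: algebra_def)

section \<open>Validity in four-element ai-semirings\<close>

locale ai_sr =
  fixes S :: "'a alg" (structure)
  assumes ai: "ai_semiring S"
begin

abbreviation "C \<equiv> alg.carrier S"

definition le :: "'a \<Rightarrow> 'a \<Rightarrow> bool" (infix "\<sqsubseteq>" 50) where
  "x \<sqsubseteq> y \<longleftrightarrow> x \<oplus> y = y"

lemma closed [simp]:
  "x \<in> C \<Longrightarrow> y \<in> C \<Longrightarrow> x \<oplus> y \<in> C"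
  "x \<in> C \<Longrightarrow> y \<in> C \<Longrightarrow> x \<otimes> y \<in> C"
  using ai by (auto simp: ai_semiring_def algebra_def)

lemma add_assoc: "x \<in> C \<Longrightarrow> y \<in> C \<Longrightarrow> z \<in> C \<Longrightarrow> (x \<oplus> y) \<oplus> z = x \<oplus> (y \<oplus> z)"
  and add_comm: "x \<in> C \<Longrightarrow> y \<in> C \<Longrightarrow> x \<oplus> y = y \<oplus> x"
  and add_idem: "x \<in> C \<Longrightarrow> x \<oplus> x = x"
  and mult_assoc: "x \<in> C \<Longrightarrow> y \<in> C \<Longrightarrow> z \<in> C \<Longrightarrow> (x \<otimes> y) \<otimes> z = x \<otimes> (y \<otimes> z)"
  and distl: "x \<in> C \<Longrightarrow> y \<in> C \<Longrightarrow> z \<in> C \<Longrightarrow> x \<otimes> (y \<oplus> z) = (x \<otimes> y) \<oplus> (x \<otimes> z)"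
  and distr: "x \<in> C \<Longrightarrow> y \<in> C \<Longrightarrow> z \<in> C \<Longrightarrow> (x \<oplus> y) \<otimes> z = (x \<otimes> z) \<oplus> (y \<otimes> z)"
  using ai unfolding ai_semiring_def by blast+

lemma le_refl: "x \<in> C \<Longrightarrow> x \<sqsubseteq> x"
  by (simp add: le_def add_idem)

lemma le_trans: "x \<in> C \<Longrightarrow> y \<in> C \<Longrightarrow> z \<in> C \<Longrightarrow> x \<sqsubseteq> y \<Longrightarrow> y \<sqsubseteq> z \<Longrightarrow> x \<sqsubseteq> z"
  by (metis le_def add_assoc)

lemma le_plusI1: "x \<in> C \<Longrightarrow> y \<in> C \<Longrightarrow> z \<in> C \<Longrightarrow> x \<sqsubseteq> y \<Longrightarrow> x \<sqsubseteq> y \<oplus> z"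
  by (metis le_def add_assoc)

lemma le_plusI2: "x \<in> C \<Longrightarrow> y \<in> C \<Longrightarrow> z \<in> C \<Longrightarrow> x \<sqsubseteq> z \<Longrightarrow> x \<sqsubseteq> y \<oplus> z"
  by (metis le_plusI1 add_comm)

lemma mult_mono:
  assumes "x \<in> C" "y \<in> C" "z \<in> C" "w \<in> C" "x \<sqsubseteq> y" "z \<sqsubseteq> w"
  shows "x \<otimes> z \<sqsubseteq> y \<otimes> w"
proof (rule le_trans)
  show "x \<otimes> z \<sqsubseteq> y \<otimes> z" using assms by (metis le_def distr)
  show "y \<otimes> z \<sqsubseteq> y \<otimes> w" using assms by (metis le_def distl)
qed (use assms in auto)

lemma ai_algebra: "algebra S"
  using ai by (simp add: ai_semiring_def)

text \<open>Without a unit the powers start at exponent 1, so \<open>pw x k\<close> is the power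
  with exponent \<open>k + 1\<close>.\<close>

fun pw :: "'a \<Rightarrow> nat \<Rightarrow> 'a" where
  "pw x 0 = x"
| "pw x (Suc k) = pw x k \<otimes> x"

lemma interp_pow_trm: "interp S \<phi> (pow_trm t k) = pw (interp S \<phi> t) k"
  by (induction k) auto

lemma pw_closed [simp]: "x \<in> C \<Longrightarrow> pw x k \<in> C"
  by (induction k) auto

lemma pw_mult: "x \<in> C \<Longrightarrow> pw x j \<otimes> pw x k = pw x (Suc (j + k))"
  by (induction k) (auto simp: mult_assoc[symmetric])

lemma pw_add_period:
  assumes "x \<in> C" "pw x i = pw x (i + p)"
  shows "pw x (i + k + m * p) = pw x (i + k)"
proof -
  have *: "pw x (i + p + k) = pw x (i + k)" for k
    using assms by (induction k) auto
  have "pw x (i + k + m * p) = pw x (i + k)" for k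
  proof (induction m)
    case (Suc m)
    have "pw x (i + k + Suc m * p) = pw x (i + p + (k + m * p))" by (simp add: algebra_simps)
    also have "\<dots> = pw x (i + k + m * p)" by (simp only: *) (simp add: algebra_simps)
    finally show ?case using Suc by simp
  qed simp
  then show ?thesis .
qed

text \<open>By pigeonhole the powers become periodic within the first five, with a period at most 4.
  All such periods divide 12, and exponent 12 lies past the preperiod.\<close>

lemma pw_12_idem:
  assumes x: "x \<in> C" and card: "card C = 4"
  shows "pw x 11 \<otimes> pw x 11 = pw x 11"
proof -
  have fin: "finite C" using card card.infinite by fastforce
  have "\<not> inj_on (pw x) {..<5}"
  proof
    assume "inj_on (pw x) {..<5}"
    then have "card (pw x ` {..<5}) = 5" by (simp add: card_image)
    moreover have "card (pw x ` {..<5}) \<le> card C"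
      using fin x by (intro card_mono) auto
    ultimately show False using card by simp
  qed
  then obtain i j where ij: "i < j" "j < 5" "pw x i = pw x j"
    unfolding inj_on_def by (metis lessThan_iff linorder_neqE_nat)
  define p where "p = j - i"
  have p: "pw x i = pw x (i + p)" "i \<le> 3" "1 \<le> p" "p \<le> 4"
    using ij by (auto simp: p_def)
  then have "p = 1 \<or> p = 2 \<or> p = 3 \<or> p = 4" by linarith
  then have "p dvd 12" by auto
  then obtain m where m: "12 = m * p" by (metis dvd_def mult.commute)
  have "pw x 11 \<otimes> pw x 11 = pw x (i + (11 - i) + m * p)"
    using p x m by (simp add: pw_mult)
  also have "\<dots> = pw x (i + (11 - i))" by (rule pw_add_period[OF x p(1)])
  finally show ?thesis using p by simp
qed

lemma sum_trm_upper:
  assumes "\<And>i. interp S \<phi> (f i) \<in> C" "\<And>k. interp S \<phi> (sum_trm f k) \<in> C" "i \<le> k"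
  shows "interp S \<phi> (f i) \<sqsubseteq> interp S \<phi> (sum_trm f k)"
  using assms(3)
proof (induction k)
  case 0 then show ?case using assms(1) by (simp add: le_refl)
next
  case (Suc k)
  then show ?case
    using assms(1,2)
    by (cases "i = Suc k") (simp_all add: le_plusI1 le_plusI2 le_refl)
qed

lemma sum_trm_mult_right:
  assumes "\<And>i. interp S \<phi> (f i) \<in> C" "\<And>k. interp S \<phi> (sum_trm f k) \<in> C" "e \<in> C"
    and "\<And>i. interp S \<phi> (f i) \<otimes> e = interp S \<phi> (f i)"
  shows "interp S \<phi> (sum_trm f k) \<otimes> e = interp S \<phi> (sum_trm f k)"
  by (induction k) (simp_all add: assms distr)

text \<open>The identity says \<open>u \<sqsubseteq> s\<close> for the values of the two terms. If
  this fails, \<open>e, s, y, u\<close> are distinct and exhaust the carrier, which leaves too few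
  values for the \<open>x i\<close>.\<close>

lemma pencil_ident_holds:
  assumes card: "card C = 4"
  shows "satisfies S (pencil_ident n)"
  unfolding satisfies_def pencil_ident_def fst_conv snd_conv
proof (intro allI impI)
  fix \<phi> :: "nat \<Rightarrow> 'a" assume \<phi>: "range \<phi> \<subseteq> C"
  define I where "I = interp S \<phi>"
  have [simp]: "I t \<in> C" for t
    unfolding I_def by (rule interp_in_carrier[OF ai_algebra \<phi>])
  have IP: "I (Plus a b) = I a \<oplus> I b" and IT: "I (Times a b) = I a \<otimes> I b" for a b
    by (simp_all add: I_def)
  define e where "e = I (unit_trm n)"
  define x where "x i = I (loc_trm n i)" for i
  define p where "p = I (base_trm n)"
  define q where "q = pw p 11"
  define y where "y = x (n + 2)"
  define s where "s = I (upper_trm n)"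
  define u where "u = I (lower_trm n)"
  define l where "l k = I (prod_trm (loc_trm n) k)" for k
  have [simp]: "e \<in> C" "x i \<in> C" "p \<in> C" "q \<in> C" "y \<in> C" "s \<in> C" "u \<in> C" "l k \<in> C" for i k
    by (auto simp: e_def x_def p_def y_def s_def u_def l_def q_def)
  have l0: "l 0 = x 0" and lS: "l (Suc k) = l k \<otimes> x (Suc k)" for k
    by (simp_all add: l_def x_def IT)
  have u: "u = l n \<otimes> x (Suc n)"
    by (simp add: u_def lower_trm_def IT l_def x_def)
  have ee: "e \<otimes> e = e"
    unfolding e_def unit_trm_def I_def interp_pow_trm
    using \<phi> card by (intro pw_12_idem) auto
  have x_eq: "x i = e \<otimes> I (Var i) \<otimes> e" for i
    by (simp add: x_def loc_trm_def IT e_def)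
  have ex: "e \<otimes> x i = x i" for i
    unfolding x_eq by (simp add: mult_assoc[symmetric] ee)
  have xe: "x i \<otimes> e = x i" for i
    unfolding x_eq by (simp add: mult_assoc ee)
  have ey: "e \<otimes> y = y" and ye: "y \<otimes> e = y" by (simp_all add: y_def ex xe)
  have el: "e \<otimes> l k = l k" for k
    by (induction k) (auto simp: l0 lS ex mult_assoc[symmetric])
  have le': "l k \<otimes> e = l k" for k
    by (induction k) (auto simp: l0 lS xe mult_assoc)
  have eu: "e \<otimes> u = u"
    by (simp add: u_def lower_trm_def l_def[symmetric] el del: prod_trm.simps)
  define \<sigma> where "\<sigma> k = I (sum_trm (loc_trm n) k)" for k
  have [simp]: "\<sigma> k \<in> C" for k by (simp add: \<sigma>_def)
  have x_le_\<sigma>: "x i \<sqsubseteq> \<sigma> k" if "i \<le> k" for i k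
    unfolding x_def \<sigma>_def I_def
    by (rule sum_trm_upper[OF _ _ that]) (simp_all flip: I_def)
  have \<sigma>e: "\<sigma> k \<otimes> e = \<sigma> k" for k
    unfolding \<sigma>_def I_def
    by (rule sum_trm_mult_right) (simp_all flip: I_def x_def add: xe)
  have p: "p = e \<oplus> \<sigma> (Suc n)"
    by (simp only: p_def base_trm_def IP e_def \<sigma>_def)
  have pe: "p \<otimes> e = p" unfolding p by (simp add: distr ee \<sigma>e)
  have e_p: "e \<sqsubseteq> p" unfolding p by (auto intro!: le_plusI1 le_refl)
  have x_p: "x i \<sqsubseteq> p" if "i \<le> Suc n" for i
    unfolding p using that by (auto intro!: le_plusI2 x_le_\<sigma>)
  have p_pw: "p \<sqsubseteq> pw p k" for k
  proof (induction k)
    case (Suc k)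
    have "p \<otimes> e \<sqsubseteq> pw p k \<otimes> p" using Suc e_p by (intro mult_mono) auto
    then show ?case by (simp add: pe)
  qed (simp add: le_refl)
  then have p_q: "p \<sqsubseteq> q" by (simp add: q_def)
  have qq: "q \<otimes> q = q" unfolding q_def by (rule pw_12_idem) (use card in auto)
  have e_q: "e \<sqsubseteq> q" using le_trans[OF _ _ _ e_p p_q] by simp
  have x_q: "x i \<sqsubseteq> q" if "i \<le> Suc n" for i using le_trans[OF _ _ _ x_p p_q] that by simp
  have l_q: "l k \<sqsubseteq> q" if "k \<le> Suc n" for k
    using that
  proof (induction k)
    case (Suc k)
    then have "l k \<otimes> x (Suc k) \<sqsubseteq> q \<otimes> q" by (intro mult_mono x_q) auto
    then show ?case by (simp add: lS qq)
  qed (simp add: l0 x_q)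
  have s: "s = ((p \<oplus> (\<sigma> n \<otimes> x (Suc n))) \<oplus> l n) \<oplus> (q \<otimes> y \<otimes> q)"
    by (simp add: s_def upper_trm_def ideal_trm_def IP IT p_def \<sigma>_def x_def l_def y_def q_def
        interp_pow_trm I_def)
  have p_s: "p \<sqsubseteq> s" unfolding s by (intro le_plusI1) (auto simp: le_refl)
  have pair_s: "\<sigma> n \<otimes> x (Suc n) \<sqsubseteq> s"
    unfolding s by (simp add: le_plusI1 le_plusI2 le_refl)
  have l_s: "l n \<sqsubseteq> s"
    unfolding s by (simp add: le_plusI1 le_plusI2 le_refl)
  have id_s: "q \<otimes> y \<otimes> q \<sqsubseteq> s" unfolding s by (rule le_plusI2) (auto intro!: le_refl)
  have e_s: "e \<sqsubseteq> s" using le_trans[OF _ _ _ e_p p_s] by simp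
  have x_s: "x i \<sqsubseteq> s" if "i \<le> Suc n" for i using le_trans[OF _ _ _ x_p p_s] that by simp
  have "u \<sqsubseteq> s"
  proof (rule ccontr)
    assume nus: "\<not> u \<sqsubseteq> s"
    \<comment> \<open>Used with \<open>a = e\<close> and \<open>b\<close> equal to \<open>e\<close>
      or \<open>u\<close>.\<close>
    have id_s': "(a \<otimes> y) \<otimes> b \<sqsubseteq> s" if "a \<in> C" "b \<in> C" "a \<sqsubseteq> q" "b \<sqsubseteq> q" for a b
      by (rule le_trans[OF _ _ _ _ id_s]) (use that in \<open>auto intro!: mult_mono le_refl\<close>)
    have y_s: "y \<sqsubseteq> s" using id_s'[of e e] e_q by (simp add: ey ye)
    have u_q: "u \<sqsubseteq> q" using l_q[of "Suc n"] by (simp add: u lS)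
    have yu_s: "y \<otimes> u \<sqsubseteq> s" using id_s'[of e u] e_q u_q by (simp add: ey)
    have ney: "\<not> e \<sqsubseteq> y"
    proof
      assume "e \<sqsubseteq> y"
      then have "e \<otimes> u \<sqsubseteq> y \<otimes> u" by (intro mult_mono le_refl) auto
      then have "u \<sqsubseteq> s" using le_trans[OF _ _ _ _ yu_s, of u] by (simp add: eu)
      then show False using nus by simp
    qed
    \<comment> \<open>If \<open>s\<close> bounded its own square, it would bound all partial
      products, including \<open>u\<close>.\<close>
    have les: "l k \<sqsubseteq> s" if "s \<otimes> s \<sqsubseteq> s" "k \<le> Suc n" for k
      using that(2)
    proof (induction k)
      case (Suc k)
      then have "l k \<otimes> x (Suc k) \<sqsubseteq> s \<otimes> s" by (intro mult_mono x_s) auto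
      then show ?case using le_trans[OF _ _ _ _ that(1)] by (simp add: lS)
    qed (simp add: l0 x_s)
    have nss: "\<not> s \<otimes> s \<sqsubseteq> s" using les[of "Suc n"] nus by (auto simp: u lS)
    \<comment> \<open>The four elements are told apart by lying below \<open>s\<close>, by lying
      above \<open>e\<close>, and by having a square below \<open>s\<close>.\<close>
    have es: "e \<noteq> s" using nss ee e_s by auto
    have dist: "y \<noteq> s" "y \<noteq> e" "u \<noteq> e" "u \<noteq> s" "u \<noteq> y"
      using ney e_s nus y_s le_refl[of e] le_refl[of u] by auto
    have "card {e, s, y, u} = 4" using es dist by auto
    moreover have "finite C" using card card.infinite by fastforce
    ultimately have C: "C = {e, s, y, u}"
      using card by (intro card_subset_eq[symmetric]) auto
    \<comment> \<open>A factor \<open>y\<close> would put \<open>u\<close> below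
      \<open>q \<otimes> y \<otimes> q\<close>: the left \<open>q\<close> absorbs the factors before
      it, the right \<open>q\<close> those after it.\<close>
    have x_ny: "x i \<noteq> y" if "i \<le> Suc n" for i
    proof
      assume xi: "x i = y"
      have "l k \<sqsubseteq> (q \<otimes> y) \<otimes> q" if "i \<le> k" "k \<le> Suc n" for k
        using that
      proof (induction k)
        case 0
        have "e \<otimes> y \<otimes> e \<sqsubseteq> q \<otimes> y \<otimes> q" by (intro mult_mono e_q le_refl) auto
        then show ?case using 0 xi by (simp add: l0 ey ye)
      next
        case (Suc k)
        show ?case
        proof (cases "i = Suc k")
          case True
          have "(l k \<otimes> y) \<otimes> e \<sqsubseteq> (q \<otimes> y) \<otimes> q"
            using Suc.prems by (intro mult_mono l_q e_q le_refl) auto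
          then show ?thesis using True xi by (simp add: lS mult_assoc ye)
        next
          case False
          then have "l k \<otimes> x (Suc k) \<sqsubseteq> ((q \<otimes> y) \<otimes> q) \<otimes> q"
            using Suc by (intro mult_mono x_q) auto
          then show ?thesis by (simp add: lS mult_assoc qq)
        qed
      qed
      from this[of "Suc n"] that have "u \<sqsubseteq> (q \<otimes> y) \<otimes> q" by (simp add: u lS)
      then show False using nus le_trans[OF _ _ _ _ id_s, of u] by simp
    qed
    have x_es: "x i = e \<or> x i = s" if "i \<le> Suc n" for i
    proof -
      have "x i \<in> C" by simp
      then have "x i \<in> {e, s, y, u}" by (simp only: C)
      then show ?thesis using x_ny[OF that] x_s[OF that] nus by auto
    qed
    \<comment> \<open>If the last factor were \<open>e\<close>, then \<open>u\<close> would collapse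
      to \<open>l n\<close>, a summand of \<open>s\<close>.\<close>
    have last: "x (Suc n) = s"
      using x_es[of "Suc n"] nus l_s u le' by auto
    \<comment> \<open>Otherwise the pair summand of \<open>s\<close> would dominate
      \<open>s \<otimes> s\<close>.\<close>
    have "x i = e" if "i \<le> n" for i
    proof (rule ccontr)
      assume "x i \<noteq> e"
      then have "x i = s" using x_es[of i] that by auto
      moreover have "x i \<otimes> x (Suc n) \<sqsubseteq> \<sigma> n \<otimes> x (Suc n)"
        using that by (intro mult_mono x_le_\<sigma> le_refl) auto
      ultimately show False
        using nss le_trans[OF _ _ _ _ pair_s, of "x i \<otimes> x (Suc n)"] last by simp
    qed
    then have "l k = e" if "k \<le> n" for k
      using that by (induction k) (auto simp: l0 lS ee)
    then have "u = s" using u last ex[of "Suc n"] by simp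
    then show False using dist by simp
  qed
  then have "s \<oplus> u = s" by (metis le_def add_comm \<open>s \<in> C\<close> \<open>u \<in> C\<close>)
  then show "interp S \<phi> (Plus (upper_trm n) (lower_trm n)) = interp S \<phi> (upper_trm n)"
    by (simp add: s_def u_def I_def)
qed

end

section \<open>Isomorphic copies inside the universe type\<close>

text \<open>The chain and the near-pencil algebras live on concrete types, whereas \<open>A4\<close>
  consists of algebras over \<open>'a\<close>.\<close>

definition transport :: "('b \<Rightarrow> 'a) \<Rightarrow> 'b alg \<Rightarrow> 'a alg" where
  "transport f S =
     \<lparr>alg.carrier = f ` alg.carrier S,
      alg.plus = \<lambda>x y. f (alg.plus S (inv_into (alg.carrier S) f x) (inv_into (alg.carrier S) f y)),
      alg.times = \<lambda>x y. f (alg.times S (inv_into (alg.carrier S) f x) (inv_into (alg.carrier S) f y))\<rparr>"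

context
  fixes f :: "'b \<Rightarrow> 'a" and S :: "'b alg"
  assumes inj: "inj_on f (alg.carrier S)" and alg: "algebra S"
begin

lemma transport_simps:
  "alg.carrier (transport f S) = f ` alg.carrier S"
  "x \<in> alg.carrier S \<Longrightarrow> y \<in> alg.carrier S \<Longrightarrow> f x \<oplus>\<^bsub>transport f S\<^esub> f y = f (x \<oplus>\<^bsub>S\<^esub> y)"
  "x \<in> alg.carrier S \<Longrightarrow> y \<in> alg.carrier S \<Longrightarrow> f x \<otimes>\<^bsub>transport f S\<^esub> f y = f (x \<otimes>\<^bsub>S\<^esub> y)"
  using inj by (simp_all add: transport_def)

lemma algebra_transport: "algebra (transport f S)"
  using alg by (auto simp: algebra_def transport_simps)

lemma ai_semiring_transport:
  assumes "ai_semiring S"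
  shows "ai_semiring (transport f S)"
proof -
  interpret ai_sr S using assms by unfold_locales
  show ?thesis
    unfolding ai_semiring_def
  proof (intro conjI ballI algebra_transport)
    fix x y z
    assume "x \<in> alg.carrier (transport f S)" "y \<in> alg.carrier (transport f S)"
      "z \<in> alg.carrier (transport f S)"
    then obtain a b c where [simp]: "a \<in> C" "b \<in> C" "c \<in> C" "x = f a" "y = f b" "z = f c"
      by (auto simp: transport_simps)
    let ?S = "transport f S"
    show "(x \<oplus>\<^bsub>?S\<^esub> y) \<oplus>\<^bsub>?S\<^esub> z = x \<oplus>\<^bsub>?S\<^esub> (y \<oplus>\<^bsub>?S\<^esub> z)" by (simp add: transport_simps add_assoc)
    show "x \<oplus>\<^bsub>?S\<^esub> y = y \<oplus>\<^bsub>?S\<^esub> x" by (simp add: transport_simps add_comm)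
    show "x \<oplus>\<^bsub>?S\<^esub> x = x" by (simp add: transport_simps add_idem)
    show "(x \<otimes>\<^bsub>?S\<^esub> y) \<otimes>\<^bsub>?S\<^esub> z = x \<otimes>\<^bsub>?S\<^esub> (y \<otimes>\<^bsub>?S\<^esub> z)" by (simp add: transport_simps mult_assoc)
    show "x \<otimes>\<^bsub>?S\<^esub> (y \<oplus>\<^bsub>?S\<^esub> z) = (x \<otimes>\<^bsub>?S\<^esub> y) \<oplus>\<^bsub>?S\<^esub> (x \<otimes>\<^bsub>?S\<^esub> z)" by (simp add: transport_simps distl)
    show "(x \<oplus>\<^bsub>?S\<^esub> y) \<otimes>\<^bsub>?S\<^esub> z = (x \<otimes>\<^bsub>?S\<^esub> z) \<oplus>\<^bsub>?S\<^esub> (y \<otimes>\<^bsub>?S\<^esub> z)" by (simp add: transport_simps distr)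
  qed
qed

lemma interp_transport:
  assumes "range \<phi> \<subseteq> alg.carrier S"
  shows "interp (transport f S) (f \<circ> \<phi>) t = f (interp S \<phi> t)"
  by (induction t) (simp_all add: transport_simps interp_in_carrier[OF alg assms])

lemma satisfies_transport: "satisfies (transport f S) e \<longleftrightarrow> satisfies S e"
proof
  assume L: "satisfies (transport f S) e"
  show "satisfies S e"
    unfolding satisfies_def
  proof (intro allI impI)
    fix \<phi> :: "nat \<Rightarrow> 'b" assume \<phi>: "range \<phi> \<subseteq> alg.carrier S"
    then have "range (f \<circ> \<phi>) \<subseteq> alg.carrier (transport f S)" by (auto simp: transport_simps)
    then have "f (interp S \<phi> (fst e)) = f (interp S \<phi> (snd e))"
      using L unfolding satisfies_def by (metis interp_transport[OF \<phi>])
    then show "interp S \<phi> (fst e) = interp S \<phi> (snd e)"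
      using inj interp_in_carrier[OF alg \<phi>] by (metis inj_onD)
  qed
next
  assume R: "satisfies S e"
  show "satisfies (transport f S) e"
    unfolding satisfies_def
  proof (intro allI impI)
    fix \<psi> :: "nat \<Rightarrow> 'a" assume "range \<psi> \<subseteq> alg.carrier (transport f S)"
    then have "\<forall>i. \<exists>x \<in> alg.carrier S. \<psi> i = f x" by (auto simp: transport_simps)
    then obtain \<phi> where "\<And>i. \<phi> i \<in> alg.carrier S" "\<And>i. \<psi> i = f (\<phi> i)" by metis
    then have \<phi>: "range \<phi> \<subseteq> alg.carrier S" "\<psi> = f \<circ> \<phi>" by auto
    then show "interp (transport f S) \<psi> (fst e) = interp (transport f S) \<psi> (snd e)"
      using R by (simp add: interp_transport satisfies_def)
  qed
qed

end

section \<open>The four-element chain and its test homomorphisms\<close>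

text \<open>The elements \<open>0, 1, 2, 3\<close> stand for \<open>0, 1, a, a\<^sup>2\<close>.\<close>

definition chain4 :: "nat alg" where
  "chain4 = \<lparr>alg.carrier = {..3}, alg.plus = max,
     alg.times = \<lambda>x y. if x = 0 \<or> y = 0 then 0 else min 3 (x + y - 1)\<rparr>"

lemma chain4_simps [simp]:
  "alg.carrier chain4 = {..3}"
  "x \<oplus>\<^bsub>chain4\<^esub> y = max x y"
  "x \<otimes>\<^bsub>chain4\<^esub> y = (if x = 0 \<or> y = 0 then 0 else min 3 (x + y - 1))"
  by (simp_all add: chain4_def)

lemma ai_semiring_chain4: "ai_semiring chain4"
proof -
  have "{..3::nat} = {0, 1, 2, 3}" by auto
  then show ?thesis by (simp add: ai_semiring_def algebra_def)
qed

text \<open>The top value 3 is a test: all letters lie in \<open>C\<close>, and at least two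
  occurrences lie in \<open>J\<close>.\<close>

definition count_hom :: "nat set \<Rightarrow> nat set \<Rightarrow> nat multiset \<Rightarrow> nat" where
  "count_hom C J m =
     (if set_mset m \<subseteq> C then min 3 (Suc (size (filter_mset (\<lambda>i. i \<in> J) m))) else 0)"

lemma count_hom_add: "count_hom C J (m + m') = count_hom C J m \<otimes>\<^bsub>chain4\<^esub> count_hom C J m'"
  by (auto simp: count_hom_def min_def)

section \<open>Expansion of terms into commutative words\<close>

text \<open>These are the monomials of \<open>t\<close> after substituting the formal sum of
  \<open>A i\<close> for variable \<open>i\<close>; each occurrence of a variable chooses its word
  independently.\<close>

primrec words :: "(nat \<Rightarrow> nat multiset set) \<Rightarrow> trm \<Rightarrow> nat multiset set" where
  "words A (Var i) = A i"
| "words A (Plus s t) = words A s \<union> words A t"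
| "words A (Times s t) = (\<lambda>(m, m'). m + m') ` (words A s \<times> words A t)"

lemma words_mono: "(\<And>i. A i \<subseteq> B i) \<Longrightarrow> words A t \<subseteq> words B t"
  by (induction t) (simp, simp, blast, force)

text \<open>A monomial needs one word per variable occurrence, and a term with \<open>size t\<close>
  binary operations has \<open>size t + 1\<close> occurrences.\<close>

lemma words_choice:
  assumes "m \<in> words A t"
  obtains A' P where "\<And>i. A' i \<subseteq> A i" "\<And>i. A' i \<subseteq> set_mset P" "m \<in> words A' t"
    "size P \<le> Suc (size t)"
  using assms
proof (induction t arbitrary: m thesis)
  case (Var i)
  show ?case
    by (rule Var.prems(1)[of "\<lambda>j. if j = i then {m} else {}" "{#m#}"]) (use Var.prems(2) in auto)
next
  case (Plus s t)
  from Plus.prems(2) consider "m \<in> words A s" | "m \<in> words A t" by auto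
  then show ?case
  proof cases
    case 1
    then obtain A' P where "\<And>i. A' i \<subseteq> A i" "\<And>i. A' i \<subseteq> set_mset P" "m \<in> words A' s"
      "size P \<le> Suc (size s)" using Plus.IH(1) by blast
    then show ?thesis using Plus.prems(1)[of A' P] by simp
  next
    case 2
    then obtain A' P where "\<And>i. A' i \<subseteq> A i" "\<And>i. A' i \<subseteq> set_mset P" "m \<in> words A' t"
      "size P \<le> Suc (size t)" using Plus.IH(2) by blast
    then show ?thesis using Plus.prems(1)[of A' P] by simp
  qed
next
  case (Times s t)
  from Times.prems(2) obtain a b where ab: "m = a + b" "a \<in> words A s" "b \<in> words A t" by auto
  obtain A1 P1 where 1: "\<And>i. A1 i \<subseteq> A i" "\<And>i. A1 i \<subseteq> set_mset P1"
    "a \<in> words A1 s" "size P1 \<le> Suc (size s)" using Times.IH(1) ab(2) by blast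
  obtain A2 P2 where 2: "\<And>i. A2 i \<subseteq> A i" "\<And>i. A2 i \<subseteq> set_mset P2"
    "b \<in> words A2 t" "size P2 \<le> Suc (size t)" using Times.IH(2) ab(3) by blast
  let ?A = "\<lambda>i. A1 i \<union> A2 i"
  have "a \<in> words ?A s" "b \<in> words ?A t"
    using 1(3) 2(3) words_mono[of A1 ?A] words_mono[of A2 ?A] by auto
  then have m: "m \<in> words ?A (Times s t)" using ab(1) by auto
  show ?case
  proof (rule Times.prems(1)[OF _ _ m])
    show "?A i \<subseteq> A i" for i using 1(1) 2(1) by blast
    show "?A i \<subseteq> set_mset (P1 + P2)" for i using 1(2)[of i] 2(2)[of i] by auto
    show "size (P1 + P2) \<le> Suc (size (Times s t))" using 1(4) 2(4) by simp
  qed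
qed

text \<open>Cuts a monomial of the other side of an identity into the pieces provided by
  \<open>words_choice\<close>.\<close>

lemma words_sum:
  assumes "m \<in> words A t" "\<And>i. A i \<subseteq> P"
  shows "\<exists>Q. set_mset Q \<subseteq> P \<and> m = \<Sum>\<^sub># Q"
  using assms(1)
proof (induction t arbitrary: m)
  case (Var i)
  then show ?case using assms(2)[of i] by (intro exI[of _ "{#m#}"]) auto
next
  case (Times s t)
  then obtain a b where "m = a + b" "a \<in> words A s" "b \<in> words A t" by auto
  with Times.IH obtain Q1 Q2 where "set_mset Q1 \<subseteq> P" "a = \<Sum>\<^sub># Q1" "set_mset Q2 \<subseteq> P" "b = \<Sum>\<^sub># Q2"
    by metis
  then show ?case using \<open>m = a + b\<close> by (intro exI[of _ "Q1 + Q2"]) auto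
qed auto

text \<open>The inserted 0 is the least element of the chain; it gives a value to empty sets
  \<open>A i\<close>, which do occur after restricting to chosen words.\<close>

definition chain_val :: "(nat multiset \<Rightarrow> nat) \<Rightarrow> (nat \<Rightarrow> nat multiset set) \<Rightarrow> nat \<Rightarrow> nat" where
  "chain_val h A i = Max (insert 0 (h ` A i))"

text \<open>In a chain a sum is one of its summands, so a term takes the largest value of
  \<open>h\<close> on its monomials. The case \<open>v t = 0\<close> covers terms without
  monomials.\<close>

lemma interp_chain_val:
  assumes h: "\<And>m m'. h (m + m') = h m \<otimes>\<^bsub>chain4\<^esub> h m'" and fin: "\<And>i. finite (A i)"
  defines "v \<equiv> interp chain4 (chain_val h A)"
  shows interp_chain_val_upper: "m \<in> words A t \<Longrightarrow> h m \<le> v t"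
    and interp_chain_val_attained: "v t = 0 \<or> (\<exists>m \<in> words A t. v t = h m)"
proof -
  show "h m \<le> v t" if "m \<in> words A t"
    using that
  proof (induction t arbitrary: m)
    case (Var i)
    then show ?case using fin by (auto simp: v_def chain_val_def intro!: Max_ge)
  next
    case (Times s t)
    then obtain a b where ab: "m = a + b" "a \<in> words A s" "b \<in> words A t" by auto
    with Times.IH[of a] Times.IH(2)[of b] have "h a \<le> v s" "h b \<le> v t" by auto
    then show ?case by (auto simp: v_def h ab(1))
  qed (auto simp: v_def le_max_iff_disj)
  show "v t = 0 \<or> (\<exists>m \<in> words A t. v t = h m)"
  proof (induction t)
    case (Var i)
    have "Max (insert 0 (h ` A i)) \<in> insert 0 (h ` A i)" using fin by (intro Max_in) auto
    then show ?case by (auto simp: v_def chain_val_def)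
  next
    case (Plus s t)
    then show ?case by (auto simp: v_def max_def)
  next
    case (Times s t)
    show ?case
    proof (cases "v s = 0 \<or> v t = 0")
      case False
      with Times obtain a b where "a \<in> words A s" "v s = h a" "b \<in> words A t" "v t = h b" by auto
      then have "a + b \<in> words A (Times s t)" "v (Times s t) = h (a + b)"
        by (auto simp: v_def h)
      then show ?thesis by blast
    qed (auto simp: v_def)
  qed
qed

text \<open>Since \<open>h (d + m)\<close> is the top 3, so is \<open>h d \<otimes> v s\<close>;
  then \<open>v s\<close> is nonzero and attained at some monomial of \<open>s\<close>, which passes
  the same test.\<close>

lemma chain4_separation:
  assumes sat: "satisfies chain4 (s, t)" and fin: "\<And>i. finite (A i)"
    and m: "m \<in> words A t" and C: "set_mset (d + m) \<subseteq> C"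
    and J: "2 \<le> size (filter_mset (\<lambda>i. i \<in> J) (d + m))"
  shows "\<exists>m' \<in> words A s. set_mset (d + m') \<subseteq> C \<and> 2 \<le> size (filter_mset (\<lambda>i. i \<in> J) (d + m'))"
proof -
  define h where "h = count_hom C J"
  define v where "v = interp chain4 (chain_val h A)"
  have h: "h (m + m') = h m \<otimes>\<^bsub>chain4\<^esub> h m'" for m m'
    unfolding h_def by (rule count_hom_add)
  have "chain_val h A i \<le> 3" for i
    unfolding chain_val_def using fin by (auto simp: h_def count_hom_def)
  then have "range (chain_val h A) \<subseteq> alg.carrier chain4" by auto
  then have vst: "v s = v t" using sat unfolding satisfies_def v_def by auto
  have "h m \<le> v s" using interp_chain_val_upper[of h A m t, OF h fin m] vst v_def by simp
  moreover have "h (d + m) = 3" using C J by (auto simp: h_def count_hom_def)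
  ultimately have 3: "h d \<otimes>\<^bsub>chain4\<^esub> v s = 3" by (auto simp: h split: if_splits)
  then have "v s \<noteq> 0" by (auto split: if_splits)
  then obtain m' where m': "m' \<in> words A s" "v s = h m'"
    using interp_chain_val_attained[of h A s, OF h fin] v_def by auto
  then have "h (d + m') = 3" using 3 h by simp
  then have "set_mset (d + m') \<subseteq> C" "2 \<le> size (filter_mset (\<lambda>i. i \<in> J) (d + m'))"
    unfolding h_def count_hom_def by (auto split: if_splits)
  then show ?thesis using m' by blast
qed

section \<open>Near-pencil words and short identities of the chain\<close>

text \<open>
  Points are the letters \<open>0, \<dots>, N\<close>; every letter above \<open>N\<close> plays the role of the bottom element,
  which may therefore be multiplied by anything.
\<close>

definition pencil_word :: "nat \<Rightarrow> nat multiset \<Rightarrow> bool" where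
  "pencil_word N m \<longleftrightarrow> (\<exists>k \<in># m. N < k) \<or> size m \<le> 1 \<or> (\<exists>i < N. m = {#i, N#}) \<or> m = mset_set {..<N}"

lemma mset_eq_mset_set: "(\<And>i. count m i \<le> 1) \<Longrightarrow> m = mset_set (set_mset m)"
  by (rule multiset_eqI) (metis One_nat_def antisym count_eq_zero_iff count_mset_set(1,3) 
      finite_set_mset le_zero_eq not_less_eq_eq not_one_le_zero)

lemma card_set_mset_le: "card (set_mset m) \<le> size m"
  by (induction m) (auto simp: card_insert_if)

text \<open>Tests by the chain force a counterexample \<open>d + m\<close> to be the whole point
  set. Then every pair \<open>{l, N}\<close> would have to be composed of \<open>d\<close> and the
  at most \<open>size t + 1\<close> words making up \<open>m\<close>, too few for large
  \<open>N\<close>.\<close>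

lemma pencil_word_transfer:
  assumes sat: "satisfies chain4 (s, t)" and fin: "\<And>i. finite (A i)"
    and N: "Suc (Suc (size t)) < N"
    and s: "\<forall>m \<in> words A s. pencil_word N (d + m)" and m: "m \<in> words A t"
  shows "pencil_word N (d + m)"
proof (rule ccontr)
  define w where "w = d + m"
  assume "\<not> pencil_word N (d + m)"
  then have bad: "\<not> pencil_word N w" by (simp add: w_def)
  have wN: "set_mset w \<subseteq> {..N}" using bad by (auto simp: pencil_word_def not_less)
  have size_w: "2 \<le> size w" using bad by (auto simp: pencil_word_def)
  \<comment> \<open>The family \<open>A\<close> is generalized, because the test is later applied to
    the subfamily \<open>A'\<close> of chosen words.\<close>
  have sep: "\<exists>m' \<in> words A s. set_mset (d + m') \<subseteq> C \<and> 2 \<le> size (filter_mset (\<lambda>i. i \<in> J) (d + m')) \<and>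
      (size (d + m') \<le> 1 \<or> (\<exists>i < N. d + m' = {#i, N#}) \<or> d + m' = mset_set {..<N})"
    if C: "set_mset w \<subseteq> C" "C \<subseteq> {..N}" and J: "2 \<le> size (filter_mset (\<lambda>i. i \<in> J) w)"
      and A: "\<And>i. finite (A i)" "m \<in> words A t" "\<forall>m \<in> words A s. pencil_word N (d + m)" for C J A
  proof -
    obtain m' where m': "m' \<in> words A s" "set_mset (d + m') \<subseteq> C"
      "2 \<le> size (filter_mset (\<lambda>i. i \<in> J) (d + m'))"
      using chain4_separation[OF sat A(1,2), of d C J] C J w_def by auto
    moreover have "pencil_word N (d + m')" using A(3) m' by blast
    moreover have "\<not> (\<exists>k \<in># d + m'. N < k)" using m'(2) C(2) by fastforce
    ultimately show ?thesis unfolding pencil_word_def by blast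
  qed
  have filter_card: "size (filter_mset (\<lambda>i. i \<in> J) (mset_set {..<N})) = card {i. i < N \<and> i \<in> J}" for J
    by (simp add: conj_commute)
  \<comment> \<open>Test with \<open>J = {i}\<close>: no block repeats a point.\<close>
  have count1: "count w i \<le> 1" for i
  proof (rule ccontr)
    assume "\<not> count w i \<le> 1"
    then have "2 \<le> size (filter_mset (\<lambda>j. j \<in> {i}) w)"
      by (simp add: count_conv_size_mset)
    from sep[OF wN order_refl this fin m s] obtain m' where
      m': "2 \<le> size (filter_mset (\<lambda>j. j \<in> {i}) (d + m'))"
      "size (d + m') \<le> 1 \<or> (\<exists>i < N. d + m' = {#i, N#}) \<or> d + m' = mset_set {..<N}" by blast
    then have "2 \<le> count (d + m') i" by (simp add: count_conv_size_mset)
    moreover have "count (d + m') i \<le> size (d + m')" by (rule count_le_size)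
    moreover have "count {#i', N#} i \<le> 1" if "i' < N" for i' using that by auto
    moreover have "count (mset_set {..<N}) i \<le> 1" by (auto simp: count_mset_set')
    ultimately show False using m'(2) by fastforce
  qed
  have w: "w = mset_set X" if "set_mset w = X" for X
    unfolding that[symmetric] by (rule mset_eq_mset_set) (rule count1)
  have card_w: "2 \<le> card (set_mset w)" using size_w w[OF refl] by (metis size_mset_set)
  \<comment> \<open>Otherwise \<open>w\<close> would have just one point below \<open>N\<close> and
    be a pair block.\<close>
  have "\<exists>i j. i \<in># w \<and> j \<in># w \<and> i < j \<and> j < N"
  proof (rule ccontr)
    assume no: "\<nexists>i j. i \<in># w \<and> j \<in># w \<and> i < j \<and> j < N"
    have "card (set_mset w - {N}) \<noteq> 0"
      using card_w by (simp add: card_Diff_singleton_if)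
    then have "set_mset w - {N} \<noteq> {}" by (metis card.empty)
    then obtain i where i: "i \<in># w" "i \<noteq> N" by blast
    have "i < N" using i wN by (auto simp: le_less)
    have "j = i \<or> j = N" if "j \<in># w" for j
      using no i \<open>i < N\<close> that wN by (metis atMost_iff le_neq_implies_less linorder_neqE_nat subsetD)
    then have sub: "set_mset w \<subseteq> {i, N}" by blast
    have "set_mset w = {i, N}"
    proof (rule card_seteq[OF _ sub])
      show "card {i, N} \<le> card (set_mset w)" using card_w \<open>i \<noteq> N\<close> by simp
    qed simp
    then have "w = mset_set {i, N}" by (rule w)
    then have "w = {#i, N#}" using \<open>i \<noteq> N\<close> by simp
    then show False using bad \<open>i < N\<close> by (auto simp: pencil_word_def)
  qed
  then obtain i j where ij: "i \<in># w" "j \<in># w" "i < j" "j < N" by blast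
  \<comment> \<open>Only the long block contains both \<open>i\<close> and \<open>j\<close>;
    choosing \<open>C\<close> as the letters of \<open>w\<close> forces this block into
    \<open>w\<close>.\<close>
  have full: "l \<in># w" if l: "l < N" for l
  proof (rule ccontr)
    assume nl: "l \<notin># w"
    have "{i, j} \<subseteq> set_mset (filter_mset (\<lambda>k. k \<in> {i, j}) w)" using ij by auto
    then have "2 \<le> card (set_mset (filter_mset (\<lambda>k. k \<in> {i, j}) w))"
      using ij by (metis card_2_iff card_mono finite_set_mset less_irrefl)
    also have "\<dots> \<le> size (filter_mset (\<lambda>k. k \<in> {i, j}) w)" by (rule card_set_mset_le)
    finally have "2 \<le> size (filter_mset (\<lambda>k. k \<in> {i, j}) w)" .
    from sep[OF order_refl wN this fin m s] obtain m' where
      m': "set_mset (d + m') \<subseteq> set_mset w" "2 \<le> size (filter_mset (\<lambda>k. k \<in> {i, j}) (d + m'))"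
      "size (d + m') \<le> 1 \<or> (\<exists>i < N. d + m' = {#i, N#}) \<or> d + m' = mset_set {..<N}" by blast
    have pair: "size (filter_mset (\<lambda>k. k \<in> {i, j}) {#i', N#}) \<le> 1" for i' using ij by auto
    from m'(3) show False
    proof (elim disjE exE conjE)
      assume "size (d + m') \<le> 1"
      then show False
        using m'(2) size_filter_mset_lesseq[of "\<lambda>k. k \<in> {i, j}" "d + m'"] by linarith
    next
      fix i' assume "d + m' = {#i', N#}"
      then show False using m'(2) pair[of i'] by (simp only:)
    next
      assume "d + m' = mset_set {..<N}"
      then have "set_mset (mset_set {..<N}) \<subseteq> set_mset w" using m'(1) by (simp only:)
      then show False using l nl by auto
    qed
  qed
  have sub: "{..<N} \<subseteq> set_mset w" using full by (simp add: subset_eq)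
  have atMost: "{..N} = insert N {..<N}" by auto
  have sup: "set_mset w \<subseteq> insert N {..<N}" using wN by (simp only: atMost)
  have "N \<in># w"
  proof (rule ccontr)
    assume "N \<notin># w"
    then have "set_mset w = {..<N}" using sub sup by (simp add: subset_insert equalityI)
    then have "w = mset_set {..<N}" by (rule w)
    then show False using bad by (simp add: pencil_word_def)
  qed
  then have w_full: "set_mset w = {..N}" unfolding atMost using sub sup by (simp add: equalityI)
  \<comment> \<open>Now every single point must be recovered from one of the few factors of \<open>w\<close>.\<close>
  obtain A' P where A': "\<And>i. A' i \<subseteq> A i" "\<And>i. A' i \<subseteq> set_mset P" "m \<in> words A' t"
    "size P \<le> Suc (size t)"
    using words_choice[OF m] by blast
  have fin': "finite (A' i)" for i using A'(1) fin finite_subset by blast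
  have s': "\<forall>m \<in> words A' s. pencil_word N (d + m)" using s words_mono[of A' A] A'(1) by blast
  have piece: "\<exists>a \<in> insert d (set_mset P). set_mset a \<inter> {..<N} = {l}" if l: "l < N" for l
  proof -
    have "{x \<in> {..N}. x \<in> {l, N}} = {l, N}" using l by auto
    then have "size (filter_mset (\<lambda>k. k \<in> {l, N}) w) = card {l, N}"
      by (simp only: w[OF w_full] filter_mset_mset_set finite_atMost size_mset_set)
    then have "2 \<le> size (filter_mset (\<lambda>k. k \<in> {l, N}) w)" using l by simp
    from sep[OF wN order_refl this fin' A'(3) s'] obtain m' where
      m': "m' \<in> words A' s" "2 \<le> size (filter_mset (\<lambda>k. k \<in> {l, N}) (d + m'))"
      "size (d + m') \<le> 1 \<or> (\<exists>i < N. d + m' = {#i, N#}) \<or> d + m' = mset_set {..<N}" by blast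
    \<comment> \<open>The long block meets \<open>{l, N}\<close> only in \<open>l\<close>, so the
      word found must be the pair block itself.\<close>
    have "size (filter_mset (\<lambda>k. k \<in> {l, N}) (mset_set {..<N})) \<le> 1"
      unfolding filter_card using card_mono[of "{l}" "{i. i < N \<and> i \<in> {l, N}}"] by auto
    then have "d + m' \<noteq> mset_set {..<N}" using m'(2) by (metis Suc_1 not_less_eq_eq order_trans One_nat_def)
    moreover have "\<not> size (d + m') \<le> 1"
      using m'(2) size_filter_mset_lesseq[of "\<lambda>k. k \<in> {l, N}" "d + m'"] by linarith
    ultimately obtain i where i: "i < N" "d + m' = {#i, N#}" using m'(3) by blast
    then have "i = l" using m'(2) by (auto split: if_splits)
    obtain Q where Q: "set_mset Q \<subseteq> set_mset P" "m' = \<Sum>\<^sub># Q" using words_sum[OF m'(1) A'(2)] by blast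
    have dQ: "\<Sum>\<^sub># (add_mset d Q) = {#l, N#}" using i \<open>i = l\<close> Q by simp
    then have "l \<in># \<Sum>\<^sub># (add_mset d Q)" by simp
    then obtain a where a: "a \<in># add_mset d Q" "l \<in># a" by auto
    have "set_mset a \<subseteq> set_mset (\<Sum>\<^sub># (add_mset d Q))" using a(1) by auto
    then have "set_mset a \<subseteq> {l, N}" by (simp only: dQ) simp
    then show ?thesis using a Q(1) l by (intro bexI[of _ a]) auto
  qed
  \<comment> \<open>Distinct \<open>l\<close> have distinct pieces, giving \<open>N\<close> pieces
    among at most \<open>size t + 2\<close>.\<close>
  then obtain g where g: "\<And>l. l < N \<Longrightarrow> g l \<in> insert d (set_mset P)"
    "\<And>l. l < N \<Longrightarrow> set_mset (g l) \<inter> {..<N} = {l}" by metis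
  have "inj_on g {..<N}" using g(2) by (metis inj_onI lessThan_iff singleton_inject)
  then have "N \<le> card (insert d (set_mset P))"
    using card_inj_on_le[of g "{..<N}" "insert d (set_mset P)"] g(1) by auto
  also have "\<dots> \<le> Suc (card (set_mset P))" by (simp add: card_insert_if)
  also have "card (set_mset P) \<le> size P" by (simp add: card_set_mset_le)
  finally show False using N A'(4) by simp
qed

section \<open>The syntactic algebra of the near-pencil\<close>

abbreviation msum :: "nat multiset set \<Rightarrow> nat multiset set \<Rightarrow> nat multiset set" where
  "msum X Y \<equiv> (\<lambda>(m, m'). m + m') ` (X \<times> Y)"

text \<open>The largest set admitting the same contexts \<open>d\<close> as \<open>A\<close>. As
  words are commutative, one-sided contexts suffice.\<close>

definition closure :: "nat \<Rightarrow> nat multiset set \<Rightarrow> nat multiset set" where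
  "closure N A = {m. \<forall>d. (\<forall>a \<in> A. pencil_word N (d + a)) \<longrightarrow> pencil_word N (d + m)}"

lemma pencil_word_closure: "(\<forall>m \<in> closure N A. pencil_word N (d + m)) \<longleftrightarrow> (\<forall>a \<in> A. pencil_word N (d + a))"
  by (auto simp: closure_def)

lemma closure_cong:
  assumes "\<And>d. (\<forall>a \<in> A. pencil_word N (d + a)) \<longleftrightarrow> (\<forall>b \<in> B. pencil_word N (d + b))"
  shows "closure N A = closure N B"
  using assms by (simp add: closure_def)

lemma closure_Un: "closure N (closure N A \<union> closure N B) = closure N (A \<union> B)"
  by (rule closure_cong) (simp add: ball_Un pencil_word_closure)

text \<open>The factors are replaced one at a time, the other one being absorbed into the
  context.\<close>

lemma closure_msum: "closure N (msum (closure N A) (closure N B)) = closure N (msum A B)"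
proof (rule closure_cong)
  fix d
  have msum: "(\<forall>a \<in> msum X Y. pencil_word N (d + a)) \<longleftrightarrow> (\<forall>x \<in> X. \<forall>y \<in> Y. pencil_word N (d + x + y))" for X Y
    by (auto simp: add.assoc)
  have left: "(\<forall>x \<in> closure N A. pencil_word N (d + x + y)) \<longleftrightarrow> (\<forall>x \<in> A. pencil_word N (d + x + y))" for y
    using pencil_word_closure[of N A "d + y"] by (simp add: add.assoc add.commute[of y])
  show "(\<forall>a \<in> msum (closure N A) (closure N B). pencil_word N (d + a)) \<longleftrightarrow>
      (\<forall>a \<in> msum A B. pencil_word N (d + a))"
    unfolding msum pencil_word_closure using left by blast
qed

text \<open>Restricting to finite sets keeps the carrier countable, hence embeddable into any
  infinite type, and makes the maxima in \<open>chain_val\<close> meaningful.\<close>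

definition pencil_alg :: "nat \<Rightarrow> nat multiset set alg" where
  "pencil_alg N = \<lparr>alg.carrier = closure N ` {A. finite A},
     alg.plus = \<lambda>X Y. closure N (X \<union> Y), alg.times = \<lambda>X Y. closure N (msum X Y)\<rparr>"

lemma algebra_pencil_alg: "algebra (pencil_alg N)"
  by (auto simp: algebra_def pencil_alg_def closure_Un closure_msum)

lemma countable_pencil_alg: "countable (alg.carrier (pencil_alg N))"
proof -
  have "range mset = (UNIV :: nat multiset set)" by (metis ex_mset surjI surj_def)
  then have "countable (UNIV :: nat multiset set)" by (metis countableI_type countable_image)
  then have "countable {A :: nat multiset set. finite A}"
    using countable_Collect_finite_subset[of "UNIV :: nat multiset set"] by simp
  then show ?thesis by (simp add: pencil_alg_def)
qed

lemma interp_pencil_alg: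
  "interp (pencil_alg N) (\<lambda>i. closure N (A i)) t = closure N (words A t)"
  by (induction t) (simp_all add: pencil_alg_def closure_Un closure_msum)

lemma satisfies_pencil_alg:
  assumes sat: "satisfies chain4 (s, t)" and N: "size s + size t + 2 < N"
  shows "satisfies (pencil_alg N) (s, t)"
  unfolding satisfies_def fst_conv snd_conv
proof (intro allI impI)
  fix \<phi> :: "nat \<Rightarrow> nat multiset set" assume "range \<phi> \<subseteq> alg.carrier (pencil_alg N)"
  then have "\<forall>i. \<exists>A. finite A \<and> \<phi> i = closure N A" by (auto simp: pencil_alg_def)
  then obtain A where fin: "\<And>i. finite (A i)" and \<phi>: "\<And>i. \<phi> i = closure N (A i)" by metis
  have \<phi>': "\<phi> = (\<lambda>i. closure N (A i))" using \<phi> by auto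
  have sat': "satisfies chain4 (t, s)" using sat by (auto simp: satisfies_def)
  have "(\<forall>m \<in> words A s. pencil_word N (d + m)) \<longleftrightarrow> (\<forall>m \<in> words A t. pencil_word N (d + m))" for d
  proof (intro iffI ballI)
    fix m assume "\<forall>m \<in> words A s. pencil_word N (d + m)" "m \<in> words A t"
    then show "pencil_word N (d + m)" by (rule pencil_word_transfer[OF sat fin, rotated]) (use N in simp)
  next
    fix m assume "\<forall>m \<in> words A t. pencil_word N (d + m)" "m \<in> words A s"
    then show "pencil_word N (d + m)" by (rule pencil_word_transfer[OF sat' fin, rotated]) (use N in simp)
  qed
  then show "interp (pencil_alg N) \<phi> s = interp (pencil_alg N) \<phi> t"
    unfolding \<phi>' interp_pencil_alg by (rule closure_cong)
qed

section \<open>Failure of the inequality and the conclusion\<close>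

lemma words_sum_trm: "words A (sum_trm f k) = (\<Union>i \<le> k. words A (f i))"
  by (induction k) (auto simp: atMost_Suc)

text \<open>The unit variable becomes the empty word, every other variable its own letter. As
  \<open>n + 2\<close> exceeds \<open>N\<close>, the ideal summand has only words with a bottom
  letter; the empty context then separates the two sides.\<close>

lemma not_satisfies_pencil_ident:
  assumes "0 < n"
  shows "\<not> satisfies (pencil_alg (Suc n)) (pencil_ident n)"
proof
  let ?N = "Suc n"
  define A :: "nat \<Rightarrow> nat multiset set" where "A i = (if i = n + 3 then {{#}} else {{#i#}})" for i
  assume sat: "satisfies (pencil_alg ?N) (pencil_ident n)"
  have "range (\<lambda>i. closure ?N (A i)) \<subseteq> alg.carrier (pencil_alg ?N)"
    by (auto simp: pencil_alg_def A_def)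
  then have "closure ?N (words A (Plus (upper_trm n) (lower_trm n))) = closure ?N (words A (upper_trm n))"
    using sat unfolding satisfies_def pencil_ident_def fst_conv snd_conv
    by (simp only: interp_pencil_alg[symmetric])
  then have "(\<forall>m \<in> closure ?N (words A (Plus (upper_trm n) (lower_trm n))). pencil_word ?N ({#} + m)) \<longleftrightarrow>
      (\<forall>m \<in> closure ?N (words A (upper_trm n)). pencil_word ?N ({#} + m))"
    by (simp only:)
  then have eq: "(\<forall>m \<in> words A (Plus (upper_trm n) (lower_trm n)). pencil_word ?N ({#} + m)) \<longleftrightarrow>
      (\<forall>m \<in> words A (upper_trm n). pencil_word ?N ({#} + m))"
    by (simp only: pencil_word_closure)
  have "words A (pow_trm (Var (n + 3)) k) = {{#}}" for k
    by (induction k) (auto simp: A_def)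
  then have unit: "words A (unit_trm n) = {{#}}" by (simp add: unit_trm_def)
  have loc: "words A (loc_trm n i) = {{#i#}}" if "i \<le> n + 2" for i
    using that by (auto simp: loc_trm_def unit A_def)
  have sum: "words A (sum_trm (loc_trm n) k) = (\<lambda>i. {#i#}) ` {..k}" if "k \<le> n + 2" for k
    using that by (auto simp: words_sum_trm loc)
  have prod: "words A (prod_trm (loc_trm n) k) = {mset_set {..k}}" if "k \<le> n + 2" for k
    using that
  proof (induction k)
    case (Suc k)
    then show ?case by (simp add: loc atMost_Suc)
  qed (simp add: loc)
  have base: "\<forall>m \<in> words A (base_trm n). pencil_word ?N m"
    by (auto simp: base_trm_def unit sum loc pencil_word_def)
  have pairs: "\<forall>m \<in> words A (Times (sum_trm (loc_trm n) n) (loc_trm n (Suc n))). pencil_word ?N m"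
    by (auto simp: sum loc pencil_word_def)
  have line: "\<forall>m \<in> words A (prod_trm (loc_trm n) n). pencil_word ?N m"
    by (simp add: prod pencil_word_def lessThan_Suc_atMost)
  have ideal: "\<forall>m \<in> words A (ideal_trm n). pencil_word ?N m"
    by (auto simp: ideal_trm_def loc pencil_word_def)
  have "\<forall>m \<in> words A (upper_trm n). pencil_word ?N m"
    unfolding upper_trm_def words.simps(2) ball_Un using base pairs line ideal by blast
  then have "pencil_word ?N (mset_set {..?N})"
    using eq prod[of ?N] unfolding lower_trm_def by simp
  moreover have "size (mset_set {..?N}) = n + 2" by simp
  \<comment> \<open>For \<open>n = 0\<close> the point set would itself be the pair block
    \<open>{0, 1}\<close>.\<close>
  moreover have "mset_set {..?N} \<noteq> {#i, ?N#}" for i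
  proof
    assume "mset_set {..?N} = {#i, ?N#}"
    then have "size (mset_set {..?N}) = 2" by simp
    then show False using assms by simp
  qed
  moreover have "mset_set {..?N} \<noteq> mset_set {..<?N}"
  proof
    assume "mset_set {..?N} = mset_set {..<?N}"
    then have "size (mset_set {..?N}) = ?N" by simp
    then show False by simp
  qed
  ultimately show False by (auto simp: pencil_word_def)
qed

lemma A4_satisfies:
  assumes "\<And>S :: 'a alg. ai_semiring S \<Longrightarrow> card (alg.carrier S) = 4 \<Longrightarrow> satisfies S e"
    and "S \<in> (A4 :: 'a alg set)"
  shows "satisfies S e"
proof -
  have "variety (models {e} :: 'a alg set)" by (auto simp: variety_def)
  moreover have "{S :: 'a alg. ai_semiring S \<and> card (alg.carrier S) = 4} \<subseteq> models {e}"
    using assms(1) by (auto simp: models_def ai_semiring_def)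
  ultimately have "(A4 :: 'a alg set) \<subseteq> models {e}"
    unfolding A4_def by (rule variety_generated_least)
  then show ?thesis using assms(2) by (auto simp: models_def)
qed

theorem theorem1p1:
  assumes "infinite (UNIV :: 'a set)"
  shows "\<not> finitely_based (A4 :: 'a alg set)"
proof
  assume "finitely_based (A4 :: 'a alg set)"
  then obtain E where E: "finite E" "(A4 :: 'a alg set) = models E"
    by (auto simp: finitely_based_def)
  obtain g :: "nat \<Rightarrow> 'a" where g: "inj g"
    using infinite_countable_subset[OF assms] by blast
  have inj_chain: "inj_on g (alg.carrier chain4)" using g by (rule inj_on_subset) simp
  have alg_chain: "algebra chain4" using ai_semiring_chain4 by (simp add: ai_semiring_def)
  have "card (alg.carrier (transport g chain4)) = 4"
    by (simp only: transport_simps(1)[OF inj_chain alg_chain] card_image[OF inj_chain]) simp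
  \<comment> \<open>A copy of the chain is one of the generators, so the chain satisfies the whole
    basis \<open>E\<close>.\<close>
  then have "transport g chain4 \<in> A4"
    unfolding A4_def
    by (intro subset_variety_generated[THEN subsetD])
      (simp add: ai_semiring_transport[OF inj_chain alg_chain ai_semiring_chain4])
  then have chain: "satisfies chain4 e" if "e \<in> E" for e
    using that satisfies_transport[OF inj_chain alg_chain] by (simp add: E(2) models_def)
  \<comment> \<open>Exceeds the sizes of all identities in the finite basis; the added 2 provides
    the margin of \<open>satisfies_pencil_alg\<close> and makes \<open>n\<close> positive.\<close>
  define n where "n = (\<Sum>(s, t) \<in> E. size s + size t) + 2"
  have bound: "size s + size t + 2 < Suc n" if "(s, t) \<in> E" for s t
    using member_le_sum[OF that, of "\<lambda>(s, t). size s + size t"] E(1) by (simp add: n_def)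
  let ?B = "pencil_alg (Suc n)"
  \<comment> \<open>The countable carrier is numbered by naturals, which \<open>g\<close> embeds
    into \<open>'a\<close>.\<close>
  have inj_B: "inj_on (g \<circ> to_nat_on (alg.carrier ?B)) (alg.carrier ?B)"
    using countable_pencil_alg g by (intro comp_inj_on inj_on_to_nat_on) (auto intro: inj_on_subset)
  note B = inj_B algebra_pencil_alg
  let ?B' = "transport (g \<circ> to_nat_on (alg.carrier ?B)) ?B"
  have "satisfies ?B e" if "e \<in> E" for e
    using that chain[OF that] bound satisfies_pencil_alg by (cases e) auto
  then have "?B' \<in> models E"
    using algebra_transport[OF B] satisfies_transport[OF B] by (auto simp: models_def)
  then have "?B' \<in> A4" using E(2) by simp
  moreover have "satisfies S (pencil_ident n)" if "ai_semiring S" "card (alg.carrier S) = 4"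
    for S :: "'a alg"
  proof -
    interpret ai_sr S using that(1) by unfold_locales
    show ?thesis by (rule pencil_ident_holds[OF that(2)])
  qed
  ultimately have "satisfies ?B' (pencil_ident n)" by (rule A4_satisfies[rotated])
  then have "satisfies ?B (pencil_ident n)" using satisfies_transport[OF B] by blast
  then show False using not_satisfies_pencil_ident[of n] by (simp add: n_def)
qed

end
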